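(* Let $H$ be a finite subgroup of a two-dimensional torus $(\mathbb{R}/\mathbb{Z})^2$. Then there exists a 3-net in $\mathbb{P}^2$ realizing $H$.
   Context: A 3-net in $\mathbb{P}^2$ is a pair $(\mathcal{A},\mathcal{X})$ where $\mathcal{A}$ is a finite set of lines in the complex projective plane partitioned into 3 classes $\mathcal{A}=\mathcal{A}_1\cup\mathcal{A}_2\cup\mathcal{A}_3$ and $\mathcal{X}$ is a finite set of points such that: (i) for every $i\neq j$ and every $l\in\mathcal{A}_i$, $l'\in\mathcal{A}_j$, $l\cap l'\in\mathcal{X}$; (ii) for every $X\in\mathcal{X}$ and every $i$ there is a unique $l\in\mathcal{A}_i$ through $X$. A 3-net realizes a group $H$ if there are bijections $\phi_i:H\to\mathcal{A}_i$ ($i=1,2,3$) such that for all $a,b\in H$ the line $\phi_3(ab)$ passes through the point $\phi_1(a)\cap\phi_2(b)$. *)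

theory Defs
  imports "HOL-Analysis.Analysis" "HOL-Algebra.Coset"
begin

text \<open>
  The complex projective plane is the projectivisation of \<open>\<complex>\<^sup>3\<close>: its points and lines are the
  complex linear subspaces of dimension one and two (\<open>vec\<close> is linear algebra over the
  coefficient field, here the complex numbers). With this encoding the intersection
  of two distinct lines, as a point of the plane, is literally the intersection of the two sets.
\<close>

definition proj_points :: "(complex ^ 3) set set" where
  "proj_points = {P. vec.subspace P \<and> vec.dim P = 1}"

definition proj_lines :: "(complex ^ 3) set set" where
  "proj_lines = {l. vec.subspace l \<and> vec.dim l = 2}"

definition passes_through :: "(complex ^ 3) set \<Rightarrow> (complex ^ 3) set \<Rightarrow> bool" where
  "passes_through l P \<longleftrightarrow> P \<subseteq> l"

text \<open>
  The three classes are indexed by the three-element type \<open>3\<close>, whose elements are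
  \<open>1\<close>, \<open>2\<close> and \<open>3\<close> (the last one being equal to \<open>0\<close>).
\<close>

definition three_net ::
  "(complex ^ 3) set set \<Rightarrow> (3 \<Rightarrow> (complex ^ 3) set set) \<Rightarrow> (complex ^ 3) set set \<Rightarrow> bool" where
  "three_net \<A> C \<X> \<longleftrightarrow>
     finite \<A> \<and> \<A> \<subseteq> proj_lines \<and>
     \<A> = (\<Union>i. C i) \<and> disjoint_family C \<and> (\<forall>i. C i \<noteq> {}) \<and>
     finite \<X> \<and> \<X> \<subseteq> proj_points \<and>
     (\<forall>i j. i \<noteq> j \<longrightarrow> (\<forall>l \<in> C i. \<forall>l' \<in> C j. l \<inter> l' \<in> \<X>)) \<and>
     (\<forall>P \<in> \<X>. \<forall>i. \<exists>!l. l \<in> C i \<and> passes_through l P)"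

definition net_realizes ::
  "(3 \<Rightarrow> (complex ^ 3) set set) \<Rightarrow> ('a, 'b) monoid_scheme \<Rightarrow> bool" where
  "net_realizes C G \<longleftrightarrow>
     (\<exists>\<phi> :: 3 \<Rightarrow> 'a \<Rightarrow> (complex ^ 3) set.
        (\<forall>i. bij_betw (\<phi> i) (carrier G) (C i)) \<and>
        (\<forall>a \<in> carrier G. \<forall>b \<in> carrier G.
           passes_through (\<phi> 3 (a \<otimes>\<^bsub>G\<^esub> b)) (\<phi> 1 a \<inter> \<phi> 2 b)))"

definition real_add_group :: "real monoid" where
  "real_add_group = \<lparr>carrier = UNIV, monoid.mult = (+), one = 0\<rparr>"

definition torus2 :: "(real set \<times> real set) monoid" where
  "torus2 = (real_add_group Mod \<int>) \<times>\<times> (real_add_group Mod \<int>)"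

lemma comm_group_real_add_group: "comm_group real_add_group"
proof (rule comm_groupI)
  fix x :: real
  show "\<exists>y\<in>carrier real_add_group. y \<otimes>\<^bsub>real_add_group\<^esub> x = \<one>\<^bsub>real_add_group\<^esub>"
    by (rule bexI[of _ "- x"]) (simp_all add: real_add_group_def)
qed (simp_all add: real_add_group_def)

lemma normal_Ints_real_add_group: "\<int> \<lhd> real_add_group"
proof -
  interpret comm_group real_add_group by (rule comm_group_real_add_group)
  have inv: "inv\<^bsub>real_add_group\<^esub> x = - x" for x
    by (rule inv_equality) (simp_all add: real_add_group_def)
  have "subgroup \<int> real_add_group"
    by (rule subgroup.intro) (simp_all add: inv, simp_all add: real_add_group_def)
  then show ?thesis
    by (rule subgroup_imp_normal)
qed

lemma group_torus2: "group torus2"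
  unfolding torus2_def
  by (intro DirProd_group normal.factorgroup_is_group normal_Ints_real_add_group)

end

theory Submission
  imports Defs "HOL-Algebra.Multiplicative_Group"
begin

text \<open>
  The torus is identified with an elliptic curve \<open>\<complex> / \<Lambda>\<close>, embedded as a plane cubic by \<open>F\<close> so that for points
  \<open>u\<close>, \<open>v\<close>, \<open>w\<close> distinct modulo \<open>\<Lambda>\<close>, \<open>F u\<close>, \<open>F v\<close>, \<open>F w\<close> are collinear iff \<open>u + v + w \<in> \<Lambda>\<close>. Three cosets
  of \<open>H\<close> with sum \<open>0\<close>, pairwise distinct, then give by duality the three classes of a net.

  To stay elementary, \<open>F\<close> is built from one explicit odd theta series \<open>wsigma\<close> with nome so small that its
  zeros can be found by estimating the series: they are exactly the points of \<open>\<Lambda>\<close>. The coordinates of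
  \<open>F\<close> are products of three translates of \<open>wsigma\<close>, chosen so that the determinant of \<open>F u\<close>, \<open>F v\<close>, \<open>F w\<close> is
  Frobenius' elliptic analogue of the Cauchy determinant, which factors by the three-term identity of
  Weierstrass into \<open>wsigma (u - v) * wsigma (u - w) * wsigma (v - w) * wsigma (u + v + w)\<close> up to a constant.
\<close>

section \<open>Absolutely convergent double series and Gaussian bounds\<close>

lemma has_sum_Times_mult:
  fixes f :: "'a \<Rightarrow> complex" and g :: "'b \<Rightarrow> complex"
  assumes "(f has_sum a) A" "(g has_sum b) B"
  shows "((\<lambda>(x, y). f x * g y) has_sum (a * b)) (A \<times> B)"
proof (rule has_sum_SigmaI)
  have f: "(\<lambda>x. norm (f x)) summable_on A" and g: "(\<lambda>y. norm (g y)) summable_on B"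
    using assms by (auto simp: summable_on_iff_abs_summable_on_complex[symmetric] has_sum_imp_summable)
  have "(\<lambda>p. norm (case p of (x, y) \<Rightarrow> f x * g y)) summable_on (A \<times> B)"
    by (subst Infinite_Sum.abs_summable_on_Sigma_iff)
       (use f g in \<open>auto simp: norm_mult infsum_cmult_right' abs_mult
         intro!: summable_on_cmult_right summable_on_cmult_left infsum_nonneg\<close>)
  then show "(\<lambda>(x, y). f x * g y) summable_on (A \<times> B)"
    by (rule abs_summable_summable)
qed (use assms in \<open>auto intro: has_sum_cmult_right has_sum_cmult_left\<close>)

lemma summable_on_exp_neg_abs_int: "(\<lambda>n::int. exp (- \<bar>real_of_int n\<bar>)) summable_on UNIV"
proof -
  have s: "(\<lambda>n::nat. exp (- real n)) summable_on UNIV"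
  proof (rule norm_summable_imp_summable_on)
    have "summable (\<lambda>n. exp (-1) ^ n :: real)"
      by (rule summable_geometric) simp
    then show "summable (\<lambda>n. norm (exp (- real n)))"
      by (simp add: exp_of_nat_mult[symmetric])
  qed
  have 1: "(\<lambda>n::int. exp (- \<bar>real_of_int n\<bar>)) summable_on {0..}"
    by (subst summable_on_reindex_bij_witness[of _ int nat UNIV "\<lambda>n. exp (- real n)"])
       (use s in auto)
  have 2: "(\<lambda>n::int. exp (- \<bar>real_of_int n\<bar>)) summable_on {..0}"
    by (subst summable_on_reindex_bij_witness[of _ "\<lambda>n. - int n" "\<lambda>n. nat (- n)" UNIV "\<lambda>n. exp (- real n)"])
       (use s in auto)
  have "(\<lambda>n::int. exp (- \<bar>real_of_int n\<bar>)) summable_on ({0..} \<union> {..<0})"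
    by (rule summable_on_Un_disjoint[OF 1 summable_on_subset_banach[OF 2]]) auto
  also have "{0..} \<union> {..<0} = (UNIV :: int set)"
    by auto
  finally show ?thesis .
qed

text \<open>Completing the square shows that the quadratic term beats the linear one by a margin of
  \<open>\<bar>n\<bar>\<close>, so the terms are dominated by a two-sided geometric series.\<close>

lemma summable_on_gaussian:
  fixes c :: real and w :: complex
  assumes "c > 0"
  shows "(\<lambda>n::int. exp (of_int n * w - of_real (c * (of_int n)\<^sup>2))) summable_on A"
proof (rule summable_on_subset_banach[OF abs_summable_summable])
  \<comment> \<open>The maximum over real \<open>x\<close> of
    \<open>(\<bar>Re w\<bar> + 1) * \<bar>x\<bar> - c * x\<^sup>2\<close>; the extra 1 yields the
    decay \<open>- \<bar>x\<bar>\<close> below.\<close>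
  define K where "K = (\<bar>Re w\<bar> + 1)\<^sup>2 / (4 * c)"
  have le: "x * Re w - c * x\<^sup>2 \<le> K - \<bar>x\<bar>" for x :: real
  proof -
    have "0 \<le> (2 * c * \<bar>x\<bar> - (\<bar>Re w\<bar> + 1))\<^sup>2 / (4 * c)"
      using assms by simp
    also have "\<dots> = K - (\<bar>Re w\<bar> + 1) * \<bar>x\<bar> + c * x\<^sup>2"
      using assms by (simp add: K_def field_simps power2_eq_square abs_mult_self_eq)
    finally show ?thesis
      using abs_ge_self[of "x * Re w"] by (simp add: abs_mult algebra_simps)
  qed
  show "(\<lambda>n::int. norm (exp (of_int n * w - of_real (c * (of_int n)\<^sup>2)))) summable_on UNIV"
  proof (rule Infinite_Sum.abs_summable_on_comparison_test')
    show "(\<lambda>n::int. exp K * exp (- \<bar>real_of_int n\<bar>)) summable_on UNIV"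
      by (intro summable_on_cmult_right summable_on_exp_neg_abs_int)
    show "norm (exp (of_int n * w - of_real (c * (of_int n)\<^sup>2))) \<le> exp K * exp (- \<bar>real_of_int n\<bar>)" for n
      using le[of "of_int n"] by (simp add: exp_add[symmetric])
  qed
qed auto

section \<open>Theta series\<close>

definition alt_sign :: "int \<Rightarrow> complex" where
  "alt_sign n = (if even n then 1 else -1)"

text \<open>Terms of Jacobi's first theta function: the weight is q^((n - 1/2)^2) with nome q =
  1/16, and in the variable z with w = 2iz the sum is -i times theta_1(z).\<close>

definition wsigma_term :: "complex \<Rightarrow> int \<Rightarrow> complex" where
  "wsigma_term w n = alt_sign n * exp (of_int (2 * n - 1) * (w / 2) - of_real (ln 2 * (of_int (2 * n - 1))\<^sup>2))"

definition wsigma :: "complex \<Rightarrow> complex" where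
  "wsigma w = infsum (wsigma_term w) UNIV"

text \<open>Over the even and the odd integers these are Jacobi's theta_3 and theta_2, with the
  squared nome 1/256 and x = iz.\<close>

definition theta_part :: "int set \<Rightarrow> complex \<Rightarrow> complex" where
  "theta_part A x = (\<Sum>\<^sub>\<infinity>k\<in>A. exp (of_int k * x - of_real (2 * ln 2 * (of_int k)\<^sup>2)))"

lemma has_sum_wsigma: "(wsigma_term w has_sum wsigma w) UNIV"
proof -
  let ?g = "\<lambda>n. exp (of_int n * (w / 2) - of_real (ln 2 * (of_int n)\<^sup>2))"
  have "?g summable_on {n. odd n}"
    by (rule summable_on_gaussian) simp
  also have "?this \<longleftrightarrow> (\<lambda>n. ?g (2 * n - 1)) summable_on UNIV"
    by (rule summable_on_reindex_bij_witness[of _ "\<lambda>n. 2 * n - 1" "\<lambda>n. (n + 1) div 2"]) (auto elim!: oddE simp: add.commute)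
  finally have "(\<lambda>n. norm (?g (2 * n - 1))) summable_on UNIV"
    by (simp only: summable_on_iff_abs_summable_on_complex)
  then have "(\<lambda>n. norm (wsigma_term w n)) summable_on UNIV"
    by (rule summable_on_cong[THEN iffD1, rotated]) (auto simp: wsigma_term_def alt_sign_def norm_mult)
  then show ?thesis
    unfolding wsigma_def by (rule has_sum_infsum[OF abs_summable_summable])
qed

lemma has_sum_theta_part:
  "((\<lambda>k. exp (of_int k * x - of_real (2 * ln 2 * (of_int k)\<^sup>2))) has_sum theta_part A x) A"
  unfolding theta_part_def by (intro has_sum_infsum summable_on_gaussian) simp

abbreviation theta_even :: "complex \<Rightarrow> complex" where
  "theta_even \<equiv> theta_part {k. even k}"

abbreviation theta_odd :: "complex \<Rightarrow> complex" where
  "theta_odd \<equiv> theta_part {k. odd k}"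

text \<open>Substituting \<open>k = m + n - 1\<close> and \<open>l = m - n\<close> in the double series separates the variables.\<close>

lemma wsigma_add_mult_wsigma_diff:
  "wsigma (x + y) * wsigma (x - y) = theta_odd x * theta_even y - theta_even x * theta_odd y"
proof -
  let ?t = "\<lambda>x k. exp (of_int k * x - of_real (2 * ln 2 * (of_int k)\<^sup>2)) :: complex"
  let ?E = "{k::int. even k}" and ?O = "{k::int. odd k}"
  let ?j = "\<lambda>(m, n). (m + n - 1, m - n) :: int \<times> int"
  let ?i = "\<lambda>(k, l). ((k + l + 1) div 2, (k - l + 1) div 2) :: int \<times> int"
  \<comment> \<open>The sign \<open>- alt_sign k\<close> is 1 for odd \<open>k\<close> and -1 for
    even \<open>k\<close>; it produces the difference of the two products.\<close>
  let ?h = "\<lambda>(k, l). - alt_sign k * (?t x k * ?t y l)"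
  have "((\<lambda>(k, l). ?t x k * ?t y l) has_sum theta_odd x * theta_even y) (?O \<times> ?E)"
    by (intro has_sum_Times_mult has_sum_theta_part)
  then have 1: "(?h has_sum theta_odd x * theta_even y) (?O \<times> ?E)"
    by (rule has_sum_cong[THEN iffD1, rotated]) (auto simp: alt_sign_def)
  have "((\<lambda>(k, l). ?t x k * ?t y l) has_sum theta_even x * theta_odd y) (?E \<times> ?O)"
    by (intro has_sum_Times_mult has_sum_theta_part)
  then have "((\<lambda>p. - (case p of (k, l) \<Rightarrow> ?t x k * ?t y l)) has_sum - (theta_even x * theta_odd y)) (?E \<times> ?O)"
    by (rule has_sum_uminusI)
  then have 2: "(?h has_sum - (theta_even x * theta_odd y)) (?E \<times> ?O)"
    by (rule has_sum_cong[THEN iffD1, rotated]) (auto simp: alt_sign_def)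
  \<comment> \<open>In the substitution \<open>k + l = 2 * m - 1\<close> is odd, so exactly one of
    \<open>k\<close> and \<open>l\<close> is even. This union is therefore the full range of
    pairs.\<close>
  have "(?h has_sum theta_odd x * theta_even y + - (theta_even x * theta_odd y)) (?O \<times> ?E \<union> ?E \<times> ?O)"
    by (rule has_sum_Un_disjoint[OF 1 2]) auto
  moreover have "((\<lambda>(m, n). wsigma_term (x + y) m * wsigma_term (x - y) n)
      has_sum wsigma (x + y) * wsigma (x - y)) (UNIV \<times> UNIV)"
    by (intro has_sum_Times_mult has_sum_wsigma)
  moreover have "?this \<longleftrightarrow> (?h has_sum wsigma (x + y) * wsigma (x - y)) (?O \<times> ?E \<union> ?E \<times> ?O)"
  proof (rule has_sum_reindex_bij_witness[of _ ?i ?j])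
    fix p :: "int \<times> int"
    show "?j (?i p) = p" if "p \<in> ?O \<times> ?E \<union> ?E \<times> ?O"
      using that by (auto elim!: oddE evenE)
    show "?h (?j p) = (case p of (m, n) \<Rightarrow> wsigma_term (x + y) m * wsigma_term (x - y) n)"
    proof (cases p)
      case (Pair m n)
      \<comment> \<open>The quadratic parts agree by the parallelogram identity (2m-1)^2 + (2n-1)^2
        = 2(m+n-1)^2 + 2(m-n)^2.\<close>
      have "of_int (2*m-1) * ((x+y)/2) - of_real (ln 2 * (of_int (2*m-1))\<^sup>2) +
          (of_int (2*n-1) * ((x-y)/2) - of_real (ln 2 * (of_int (2*n-1))\<^sup>2)) =
          of_int (m+n-1) * x - of_real (2 * ln 2 * (of_int (m+n-1))\<^sup>2) +
          (of_int (m-n) * y - of_real (2 * ln 2 * (of_int (m-n))\<^sup>2))"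
        by (simp add: field_simps power2_eq_square)
      then have "exp (of_int (2*m-1) * ((x+y)/2) - of_real (ln 2 * (of_int (2*m-1))\<^sup>2)) *
          exp (of_int (2*n-1) * ((x-y)/2) - of_real (ln 2 * (of_int (2*n-1))\<^sup>2)) =
          ?t x (m+n-1) * ?t y (m-n)"
        by (simp only: exp_add[symmetric])
      moreover have "alt_sign m * alt_sign n = - alt_sign (m + n - 1)"
        by (simp add: alt_sign_def)
      ultimately show ?thesis
        unfolding Pair wsigma_term_def prod.case by (metis (no_types, lifting) mult.assoc mult.left_commute)
    qed
  qed auto
  ultimately show ?thesis
    using has_sum_unique by fastforce
qed

section \<open>Oddness and quasi-periods of the theta series\<close>

lemma wsigma_minus: "wsigma (- w) = - wsigma w"
proof -
  have "((\<lambda>n. - wsigma_term w n) has_sum - wsigma w) UNIV"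
    by (rule has_sum_uminusI[OF has_sum_wsigma])
  also have "?this \<longleftrightarrow> (wsigma_term (- w) has_sum - wsigma w) UNIV"
  \<comment> \<open>Replacing \<open>n\<close> by \<open>1 - n\<close> negates
    \<open>2 * n - 1\<close> and changes the parity of \<open>n\<close>.\<close>
  proof (rule has_sum_reindex_bij_witness[of _ "\<lambda>n. 1 - n" "\<lambda>n. 1 - n"])
    fix n :: int
    have "of_int (2 * (1 - n) - 1) * (- w / 2) - of_real (ln 2 * (of_int (2 * (1 - n) - 1))\<^sup>2) =
          of_int (2 * n - 1) * (w / 2) - complex_of_real (ln 2 * (of_int (2 * n - 1))\<^sup>2)"
      by (simp add: field_simps power2_eq_square)
    then show "wsigma_term (- w) (1 - n) = - wsigma_term w n"
      unfolding wsigma_term_def by (simp only:) (simp add: alt_sign_def)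
  qed auto
  finally show ?thesis
    using has_sum_wsigma has_sum_unique by blast
qed

lemma wsigma_diff_commute: "wsigma (y - x) = - wsigma (x - y)"
  using wsigma_minus[of "x - y"] by simp

lemma wsigma_0: "wsigma 0 = 0"
  using wsigma_minus[of 0] by simp

lemma wsigma_add_2pi: "wsigma (w + 2 * pi * \<i>) = - wsigma w"
proof -
  have "wsigma_term (w + 2 * pi * \<i>) n = - wsigma_term w n" for n
  proof -
    have "of_int (2 * n - 1) * ((w + 2 * pi * \<i>) / 2) - of_real (ln 2 * (of_int (2 * n - 1))\<^sup>2) =
        (of_int (2 * n - 1) * (w / 2) - of_real (ln 2 * (of_int (2 * n - 1))\<^sup>2)) +
        \<i> * of_real pi * of_int (2 * n - 1)"
      by (simp add: field_simps)
    moreover have "exp (\<i> * of_real pi * of_int (2 * n - 1)) = -1"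
      using exp_integer_2pi_plus1[of "of_int (n - 1)"] by (simp add: algebra_simps)
    ultimately show ?thesis
      unfolding wsigma_term_def by (simp only: exp_add) simp
  qed
  then show ?thesis
    unfolding wsigma_def by (simp add: infsum_uminus[symmetric] cong: infsum_cong)
qed

text \<open>Since (2n+1)^2 = (2n-1)^2 + 8n, raising the index by one absorbs the translation: the
  exponent changes by \<open>w + 4 * ln 2\<close>, independently of \<open>n\<close>, and the
  alternating sign flips.\<close>

lemma wsigma_add_8ln2: "wsigma (w + 8 * of_real (ln 2)) = - exp (w + 4 * of_real (ln 2)) * wsigma w"
proof -
  have "((\<lambda>n. - exp (w + 4 * of_real (ln 2)) * wsigma_term w n) has_sum - exp (w + 4 * of_real (ln 2)) * wsigma w) UNIV"
    by (intro has_sum_cmult_right has_sum_wsigma)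
  also have "?this \<longleftrightarrow> (wsigma_term (w + 8 * of_real (ln 2)) has_sum - exp (w + 4 * of_real (ln 2)) * wsigma w) UNIV"
  proof (rule has_sum_reindex_bij_witness[of _ "\<lambda>n. n - 1" "\<lambda>n. n + 1"])
    fix n :: int
    have "of_int (2 * (n + 1) - 1) * ((w + 8 * of_real (ln 2)) / 2) - of_real (ln 2 * (of_int (2 * (n + 1) - 1))\<^sup>2) =
          (w + 4 * of_real (ln 2)) + (of_int (2 * n - 1) * (w / 2) - of_real (ln 2 * (of_int (2 * n - 1))\<^sup>2))"
      by (simp add: field_simps power2_eq_square)
    then show "wsigma_term (w + 8 * of_real (ln 2)) (n + 1) = - exp (w + 4 * of_real (ln 2)) * wsigma_term w n"
      unfolding wsigma_term_def by (simp only: exp_add[of "w + 4 * of_real (ln 2)"]) (simp add: alt_sign_def)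
  qed auto
  finally show ?thesis
    using has_sum_wsigma has_sum_unique by blast
qed

section \<open>Zeros\<close>

text \<open>The quotient of the two differences is the sum of the \<open>2 * m + 1\<close>
  exponentials exp(jw) with |j| at most m, each of norm at most \<open>exp (b * m)\<close>. The form
  without division also covers a vanishing denominator.\<close>

lemma norm_exp_odd_diff_le:
  fixes w :: complex and b :: real
  assumes "\<bar>Re w\<bar> \<le> b"
  shows "norm (exp (of_nat (2 * m + 1) * (w / 2)) - exp (- (of_nat (2 * m + 1) * (w / 2))))
    \<le> real (2 * m + 1) * exp (b * real m) * norm (exp (w / 2) - exp (- (w / 2)))"
proof (induction m)
  case 0
  then show ?case by simp
next
  case (Suc m)
  let ?E = "\<lambda>m. exp (of_nat (2 * m + 1) * (w / 2)) - exp (- (of_nat (2 * m + 1) * (w / 2)))"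
  let ?X = "exp (w / 2) - exp (- (w / 2))"
  \<comment> \<open>The two new summands belong to j = m + 1 and j = -(m + 1).\<close>
  have step: "?E (Suc m) = ?E m + exp (of_nat (Suc m) * w) * ?X + exp (- (of_nat (Suc m) * w)) * ?X"
  proof -
    have 1: "of_nat (2 * Suc m + 1) * (w / 2) = of_nat (Suc m) * w + w / 2"
      and 2: "of_nat (2 * m + 1) * (w / 2) = of_nat (Suc m) * w + - (w / 2)"
      by (simp_all add: field_simps)
    show ?thesis
      unfolding 1 2 minus_add_distrib exp_add minus_minus by (simp only: ring_distribs) simp
  qed
  have b: "b \<ge> 0"
    using assms by linarith
  have le: "\<bar>real (Suc m) * Re w\<bar> \<le> b * real (Suc m)"
    using assms by (simp add: abs_mult mult.commute mult_right_mono)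
  have 1: "norm (exp (of_nat (Suc m) * w)) \<le> exp (b * real (Suc m))"
    using assms by simp
  have 2: "norm (exp (- (of_nat (Suc m) * w))) \<le> exp (b * real (Suc m))"
    using le by simp
  have "norm (?E (Suc m)) \<le> norm (?E m) + norm (exp (of_nat (Suc m) * w) * ?X) + norm (exp (- (of_nat (Suc m) * w)) * ?X)"
    unfolding step by (intro order_trans[OF norm_triangle_ineq] add_mono norm_triangle_ineq order_refl)
  also have "\<dots> \<le> real (2 * m + 1) * exp (b * real (Suc m)) * norm ?X + exp (b * real (Suc m)) * norm ?X
      + exp (b * real (Suc m)) * norm ?X"
  proof (intro add_mono)
    show "norm (?E m) \<le> real (2 * m + 1) * exp (b * real (Suc m)) * norm ?X"
      by (rule order_trans[OF Suc.IH], intro mult_right_mono mult_left_mono)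
         (use b in \<open>auto intro: mult_left_mono\<close>)
  qed (use 1 2 in \<open>simp_all only: norm_mult mult_right_mono norm_ge_zero\<close>)
  also have "\<dots> = real (2 * Suc m + 1) * exp (b * real (Suc m)) * norm ?X"
    by (simp add: algebra_simps)
  finally show ?case .
qed

text \<open>The indices \<open>m + 1\<close> and \<open>- m\<close> give opposite values of
  \<open>2 * n - 1\<close>; pairing them turns each summand into a multiple of
  \<open>exp (w / 2) - exp (- (w / 2))\<close>.\<close>

lemma wsigma_has_sum_pairs:
  "((\<lambda>m::nat. wsigma_term w (int m + 1) + wsigma_term w (- int m)) has_sum wsigma w) UNIV"
proof -
  have s: "wsigma_term w summable_on A" for A
    using has_sum_wsigma has_sum_imp_summable summable_on_subset_banach subset_UNIV by metis
  have 1: "((\<lambda>m::nat. wsigma_term w (int m + 1)) has_sum infsum (wsigma_term w) {1..}) UNIV"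
    by (subst has_sum_reindex_bij_witness[of _ "\<lambda>n. nat (n - 1)" "\<lambda>m. int m + 1" "{1..}" "wsigma_term w", OF _ _ _ _ _ refl])
       (auto intro: s has_sum_infsum)
  have 2: "((\<lambda>m::nat. wsigma_term w (- int m)) has_sum infsum (wsigma_term w) {..0}) UNIV"
    by (subst has_sum_reindex_bij_witness[of _ "\<lambda>n. nat (- n)" "\<lambda>m. - int m" "{..0}" "wsigma_term w", OF _ _ _ _ _ refl])
       (auto intro: s has_sum_infsum)
  have "infsum (wsigma_term w) ({1..} \<union> {..0}) = infsum (wsigma_term w) {1..} + infsum (wsigma_term w) {..0}"
    by (intro infsum_Un_disjoint s) auto
  moreover have "{1..} \<union> {..0} = (UNIV :: int set)"
    by auto
  ultimately show ?thesis
    using has_sum_add[OF 1 2] by (simp add: wsigma_def)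
qed

lemma wsigma_term_pair:
  "wsigma_term w (int m + 1) + wsigma_term w (- int m) =
     alt_sign (int m + 1) * exp (- of_real (ln 2 * (real (2 * m + 1))\<^sup>2)) *
       (exp (of_nat (2 * m + 1) * (w / 2)) - exp (- (of_nat (2 * m + 1) * (w / 2))))"
proof -
  let ?q = "complex_of_real (ln 2 * (real (2 * m + 1))\<^sup>2)" and ?z = "of_nat (2 * m + 1) * (w / 2)"
  have "of_int (2 * (int m + 1) - 1) * (w / 2) - of_real (ln 2 * (of_int (2 * (int m + 1) - 1))\<^sup>2) = ?z - ?q"
    by (simp add: algebra_simps)
  moreover have "of_int (2 * (- int m) - 1) * (w / 2) - of_real (ln 2 * (of_int (2 * (- int m) - 1))\<^sup>2) = - ?z - ?q"
    by (simp add: algebra_simps power2_eq_square add_divide_distrib)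
  ultimately have "wsigma_term w (int m + 1) + wsigma_term w (- int m) =
      alt_sign (int m + 1) * exp (?z - ?q) + alt_sign (- int m) * exp (- ?z - ?q)"
    unfolding wsigma_term_def by (simp only:)
  also have "\<dots> = alt_sign (int m + 1) * exp (- ?q) * (exp ?z - exp (- ?z))"
    unfolding diff_conv_add_uminus exp_add by (simp add: alt_sign_def algebra_simps)
  finally show ?thesis .
qed

text \<open>The first pair dominates: its norm is half that of the common factor
  \<open>exp (w / 2) - exp (- (w / 2))\<close>, and all other pairs together have at most 3/13 of
  this size. The strip is one real period wide, so its translates cover the plane.\<close>

lemma wsigma_nonzero_strip:
  assumes "\<bar>Re w\<bar> \<le> 4 * ln 2" and X: "exp (w / 2) \<noteq> exp (- (w / 2))"
  shows "wsigma w \<noteq> 0"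
proof
  assume zero: "wsigma w = 0"
  let ?p = "\<lambda>m::nat. wsigma_term w (int m + 1) + wsigma_term w (- int m)"
  let ?X = "norm (exp (w / 2) - exp (- (w / 2)))"
  have "norm (?p 0) = exp (- ln 2) * ?X"
    unfolding wsigma_term_pair norm_mult by (simp add: alt_sign_def)
  then have p0: "norm (?p 0) = ?X / 2"
    by (simp add: exp_minus)
  have pm: "norm (?p m) \<le> ?X / 2 * (3 / 16) ^ m" if "m \<in> {1..}" for m
  proof -
    have "norm (?p m) = exp (- (ln 2 * (real (2 * m + 1))\<^sup>2)) *
        norm (exp (of_nat (2 * m + 1) * (w / 2)) - exp (- (of_nat (2 * m + 1) * (w / 2))))"
      unfolding wsigma_term_pair norm_mult by (simp add: alt_sign_def)
    also have "\<dots> \<le> exp (- (ln 2 * (real (2 * m + 1))\<^sup>2)) * (real (2 * m + 1) * exp (4 * ln 2 * real m) * ?X)"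
      by (intro mult_left_mono norm_exp_odd_diff_le assms) auto
    also have "\<dots> = exp (- (ln 2 * (real (2 * m + 1))\<^sup>2) + 4 * ln 2 * real m) * real (2 * m + 1) * ?X"
      by (simp only: exp_add mult_ac)
    also have "- (ln 2 * (real (2 * m + 1))\<^sup>2) + 4 * ln 2 * real m = - (ln 2 * real (1 + 4 * m\<^sup>2))"
      by (simp add: algebra_simps power2_eq_square)
    \<comment> \<open>Here \<open>m\<^sup>2\<close> is at least \<open>m\<close>; this linear
      exponent makes the bound geometric with ratio 1/16.\<close>
    also have "\<dots> \<le> - (ln 2 * real (1 + 4 * m))"
      using that by (simp add: power2_eq_square)
    also have "exp (- (ln 2 * real (1 + 4 * m))) = (1 / 2) ^ (1 + 4 * m)"
      by (simp only: exp_minus exp_of_nat2_mult) (simp add: power_divide inverse_eq_divide)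
    also have "\<dots> = 1 / 2 * (1 / 16) ^ m"
      by (simp add: power_add power_mult power_divide)
    \<comment> \<open>The polynomial factor costs a factor of 3 in the ratio, which becomes
      3/16.\<close>
    also have "real (2 * m + 1) \<le> 3 ^ m"
    proof (induction m)
      case (Suc m)
      have "(1::real) \<le> 3 ^ m" by simp
      with Suc show ?case by simp
    qed simp
    also have "1 / 2 * (1 / 16) ^ m * 3 ^ m * ?X = ?X / 2 * (3 / 16) ^ m"
      by (simp add: power_divide)
    finally show ?thesis
      by (simp add: mult_right_mono mult_left_mono)
  qed
  have "(?p has_sum (0 - ?p 0)) (UNIV - {0})"
  proof (rule has_sum_Diff[OF wsigma_has_sum_pairs[of w, unfolded zero]])
    show "(?p has_sum ?p 0) {0}"
      using has_sum_finite[of "{0}" ?p] by simp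
  qed auto
  also have "UNIV - {0} = {1::nat..}"
    by auto
  finally have "norm (0 - ?p 0) \<le> ?X / 2 * ((3 / 16) / (1 - 3 / 16))"
    by (rule norm_infsum_le[OF _ has_sum_cmult_right[OF has_sum_geometric_from_1] pm]) auto
  then have "?X / 2 \<le> ?X / 2 * ((3 / 16) / (1 - 3 / 16))"
    unfolding diff_0 norm_minus_cancel p0 .
  then show False
    using X by simp
qed

text \<open>The lattice generated by \<open>8 * ln 2\<close> and \<open>2 * pi * \<i>\<close>. As it
  is rectangular, real and imaginary parts can be tested separately.\<close>

definition period_lattice :: "complex set" where
  "period_lattice = {w. Re w / (8 * ln 2) \<in> \<int> \<and> Im w / (2 * pi) \<in> \<int>}"

lemma period_lattice_0 [simp]: "0 \<in> period_lattice"
  by (simp add: period_lattice_def)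

lemma period_lattice_minus_iff [simp]: "- x \<in> period_lattice \<longleftrightarrow> x \<in> period_lattice"
  by (simp add: period_lattice_def)

lemma period_lattice_add:
  "x \<in> period_lattice \<Longrightarrow> y \<in> period_lattice \<Longrightarrow> x + y \<in> period_lattice"
  by (simp add: period_lattice_def add_divide_distrib)

lemma period_lattice_diff:
  "x \<in> period_lattice \<Longrightarrow> y \<in> period_lattice \<Longrightarrow> x - y \<in> period_lattice"
  by (simp add: period_lattice_def diff_divide_distrib)

lemma wsigma_add_8ln2_eq_0_iff: "wsigma (w + of_int n * (8 * of_real (ln 2))) = 0 \<longleftrightarrow> wsigma w = 0"
proof -
  have step: "wsigma (w + 8 * of_real (ln 2)) = 0 \<longleftrightarrow> wsigma w = 0" for w
    by (simp add: wsigma_add_8ln2)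
  show ?thesis
  proof (induction n rule: int_induct[of _ 0])
    case (step1 i)
    then show ?case
      using step[of "w + of_int i * (8 * of_real (ln 2))"] by (simp add: algebra_simps)
  next
    case (step2 i)
    then show ?case
      using step[of "w + of_int (i - 1) * (8 * of_real (ln 2))"] by (simp add: algebra_simps)
  qed simp
qed

lemma wsigma_add_2pi_eq_0_iff: "wsigma (w + of_int n * (2 * pi * \<i>)) = 0 \<longleftrightarrow> wsigma w = 0"
proof (induction n rule: int_induct[of _ 0])
  case (step1 i)
  then show ?case
    using wsigma_add_2pi[of "w + of_int i * (2 * pi * \<i>)"] by (simp add: algebra_simps)
next
  case (step2 i)
  then show ?case
    using wsigma_add_2pi[of "w + of_int (i - 1) * (2 * pi * \<i>)"] by (simp add: algebra_simps)
qed simp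

text \<open>The zero at 0 coming from oddness is carried to the whole lattice by the quasi-periods,
  whose multipliers never vanish. Conversely, a real period moves any zero into the strip, where
  only the solutions of \<open>exp (w / 2) = exp (- (w / 2))\<close> remain.\<close>

lemma wsigma_eq_0_iff: "wsigma w = 0 \<longleftrightarrow> w \<in> period_lattice"
proof
  assume "w \<in> period_lattice"
  then obtain n m where "Re w = of_int n * (8 * ln 2)" "Im w = of_int m * (2 * pi)"
    unfolding period_lattice_def by (auto elim!: Ints_cases simp: field_simps)
  then have "w = 0 + of_int n * (8 * of_real (ln 2)) + of_int m * (2 * pi * \<i>)"
    by (simp add: complex_eq_iff)
  then show "wsigma w = 0"
    using wsigma_add_2pi_eq_0_iff wsigma_add_8ln2_eq_0_iff wsigma_0 by metis
next
  assume zero: "wsigma w = 0"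
  \<comment> \<open>Rounding to the nearest integer leaves a real part of at most half a period,
    \<open>4 * ln 2\<close>.\<close>
  define n where "n = round (Re w / (8 * ln 2))"
  define v where "v = w + of_int (- n) * (8 * of_real (ln 2))"
  have "\<bar>of_int n - Re w / (8 * ln 2)\<bar> \<le> 1 / 2"
    unfolding n_def by (rule of_int_round_abs_le)
  then have "\<bar>of_int n - Re w / (8 * ln 2)\<bar> * (8 * ln 2) \<le> 4 * ln 2"
    by simp
  also have "\<bar>of_int n - Re w / (8 * ln 2)\<bar> * (8 * ln 2) = \<bar>(of_int n - Re w / (8 * ln 2)) * (8 * ln 2)\<bar>"
    by (simp add: abs_mult)
  also have "(of_int n - Re w / (8 * ln 2)) * (8 * ln 2) = - Re v"
    by (simp add: v_def field_simps)
  finally have "\<bar>Re v\<bar> \<le> 4 * ln 2"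
    by simp
  moreover have "wsigma v = 0"
    unfolding v_def wsigma_add_8ln2_eq_0_iff by (rule zero)
  ultimately have "exp (v / 2) = exp (- (v / 2))"
    using wsigma_nonzero_strip by blast
  then obtain k :: int where "v / 2 = - (v / 2) + of_int (2 * k) * pi * \<i>"
    using exp_eq by auto
  then have "v = of_int k * (2 * pi * \<i>)"
    by (simp add: algebra_simps)
  then have "Re v = 0" "Im v = of_int k * (2 * pi)"
    by simp_all
  then have "Re w = of_int n * (8 * ln 2)" "Im w = of_int k * (2 * pi)"
    unfolding v_def by (simp_all)
  then show "w \<in> period_lattice"
    by (simp add: period_lattice_def)
qed

section \<open>Determinants and collinearity\<close>

text \<open>The three-term identity of Weierstrass. With \<open>[a, b] = theta_odd a * theta_even b - theta_even a * theta_odd b\<close>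
  it is the Pluecker relation between \<open>s + y\<close>, \<open>s + y'\<close>, \<open>s - x'\<close>, \<open>s - x\<close>, where \<open>2 s = t + x + x'\<close>.\<close>

lemma wsigma_three_term:
  "wsigma (t + x + y) * wsigma (x' + y) * (wsigma (t + x' + y') * wsigma (x + y'))
   - wsigma (t + x' + y) * wsigma (x + y) * (wsigma (t + x + y') * wsigma (x' + y'))
   = wsigma t * wsigma (x - x') * (wsigma (t + x + x' + y + y') * wsigma (y - y'))"
proof -
  define s where "s = (t + x + x') / 2"
  have 1: "wsigma (t + x + y) * wsigma (x' + y) =
      theta_odd (s + y) * theta_even (s - x') - theta_even (s + y) * theta_odd (s - x')"
    by (subst wsigma_add_mult_wsigma_diff[symmetric], rule arg_cong2[of _ _ _ _ "\<lambda>a b. wsigma a * wsigma b"])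
       (simp_all add: s_def field_simps)
  have 2: "wsigma (t + x' + y') * wsigma (x + y') =
      theta_odd (s + y') * theta_even (s - x) - theta_even (s + y') * theta_odd (s - x)"
    by (subst wsigma_add_mult_wsigma_diff[symmetric], rule arg_cong2[of _ _ _ _ "\<lambda>a b. wsigma a * wsigma b"])
       (simp_all add: s_def field_simps)
  have 3: "wsigma (t + x' + y) * wsigma (x + y) =
      theta_odd (s + y) * theta_even (s - x) - theta_even (s + y) * theta_odd (s - x)"
    by (subst wsigma_add_mult_wsigma_diff[symmetric], rule arg_cong2[of _ _ _ _ "\<lambda>a b. wsigma a * wsigma b"])
       (simp_all add: s_def field_simps)
  have 4: "wsigma (t + x + y') * wsigma (x' + y') =
      theta_odd (s + y') * theta_even (s - x') - theta_even (s + y') * theta_odd (s - x')"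
    by (subst wsigma_add_mult_wsigma_diff[symmetric], rule arg_cong2[of _ _ _ _ "\<lambda>a b. wsigma a * wsigma b"])
       (simp_all add: s_def field_simps)
  have 5: "wsigma (t + x + x' + y + y') * wsigma (y - y') =
      theta_odd (s + y) * theta_even (s + y') - theta_even (s + y) * theta_odd (s + y')"
    by (subst wsigma_add_mult_wsigma_diff[symmetric], rule arg_cong2[of _ _ _ _ "\<lambda>a b. wsigma a * wsigma b"])
       (simp_all add: s_def field_simps)
  have 6: "wsigma t * wsigma (x - x') =
      theta_odd (s - x') * theta_even (s - x) - theta_even (s - x') * theta_odd (s - x)"
    by (subst wsigma_add_mult_wsigma_diff[symmetric], rule arg_cong2[of _ _ _ _ "\<lambda>a b. wsigma a * wsigma b"])
       (simp_all add: s_def field_simps)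
  show ?thesis
    unfolding 1 2 3 4 5 6 by (simp add: algebra_simps)
qed

text \<open>An entry \<open>wsigma (t + x + a) / wsigma (x + a)\<close> of the elliptic Cauchy
  matrix with its denominators cleared. Rotating \<open>a\<close>, \<open>b\<close>,
  \<open>c\<close> gives the three coordinates; \<open>t + a + b + c\<close> stays fixed, so all
  three have the same quasi-periodicity factors.\<close>

definition cubic_coord :: "complex \<Rightarrow> complex \<Rightarrow> complex \<Rightarrow> complex \<Rightarrow> complex \<Rightarrow> complex" where
  "cubic_coord t a b c x = wsigma (t + x + a) * wsigma (x + b) * wsigma (x + c)"

text \<open>The 3 by 3 determinant with rows at \<open>u\<close>, \<open>v\<close>,
  \<open>w\<close>, expanded along the row of \<open>u\<close>.\<close>

definition cubic_det :: "complex \<Rightarrow> complex \<Rightarrow> complex \<Rightarrow> complex \<Rightarrow> complex \<Rightarrow> complex \<Rightarrow> complex \<Rightarrow> complex" where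
  "cubic_det t a b c u v w =
     cubic_coord t a b c u * (cubic_coord t b c a v * cubic_coord t c a b w - cubic_coord t c a b v * cubic_coord t b c a w)
   + cubic_coord t b c a u * (cubic_coord t c a b v * cubic_coord t a b c w - cubic_coord t a b c v * cubic_coord t c a b w)
   + cubic_coord t c a b u * (cubic_coord t a b c v * cubic_coord t b c a w - cubic_coord t b c a v * cubic_coord t a b c w)"

text \<open>A cyclic permutation of three columns is even. This allows any of the three coordinates
  at \<open>u\<close> to serve as pivot.\<close>

lemma cubic_det_rotate: "cubic_det t b c a u v w = cubic_det t a b c u v w"
  unfolding cubic_det_def by (simp add: algebra_simps)

text \<open>Condensing along a nonzero pivot, the three-term identity applies to the \<open>2 \<times> 2\<close> minors and then to
  the determinant of these minors (Frobenius' elliptic Cauchy determinant).\<close>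

lemma cubic_det_pivot:
  assumes "cubic_coord t a b c u \<noteq> 0"
  shows "cubic_det t a b c u v w =
    (wsigma t)\<^sup>2 * (wsigma (u - v) * wsigma (u - w) * wsigma (v - w)) *
    (wsigma (a - b) * wsigma (a - c) * wsigma (b - c)) * wsigma (t + u + v + w + a + b + c)"
proof -
  let ?f = "cubic_coord t a b c" and ?g = "cubic_coord t b c a" and ?h = "cubic_coord t c a b"
  have g: "?f u * ?g z - ?g u * ?f z =
      wsigma (u + c) * wsigma (z + c) * (wsigma t * wsigma (u - z) * (wsigma (t + u + z + a + b) * wsigma (a - b)))" for z
    unfolding cubic_coord_def wsigma_three_term[of t u a z b, symmetric] by (simp add: algebra_simps)
  have h: "?f u * ?h z - ?h u * ?f z =
      wsigma (u + b) * wsigma (z + b) * (wsigma t * wsigma (u - z) * (wsigma (t + u + z + a + c) * wsigma (a - c)))" for z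
    unfolding cubic_coord_def wsigma_three_term[of t u a z c, symmetric] by (simp add: algebra_simps)
  \<comment> \<open>Up to common factors the minors have the same Cauchy shape with
    \<open>?T\<close> in place of \<open>t\<close>, so the three-term identity applies once
    more.\<close>
  let ?T = "t + u + a"
  have T: "wsigma (?T + v + b) * wsigma (w + b) * (wsigma (?T + w + c) * wsigma (v + c))
      - wsigma (?T + w + b) * wsigma (v + b) * (wsigma (?T + v + c) * wsigma (w + c))
      = wsigma ?T * wsigma (v - w) * (wsigma (?T + v + w + b + c) * wsigma (b - c))"
    by (rule wsigma_three_term)
  have eqs: "t + u + v + a + b = ?T + v + b" "t + u + w + a + b = ?T + w + b"
    "t + u + v + a + c = ?T + v + c" "t + u + w + a + c = ?T + w + c"
    "t + u + v + w + a + b + c = ?T + v + w + b + c"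
    by simp_all
  have "?f u * cubic_det t a b c u v w =
      (?f u * ?g v - ?g u * ?f v) * (?f u * ?h w - ?h u * ?f w)
      - (?f u * ?h v - ?h u * ?f v) * (?f u * ?g w - ?g u * ?f w)"
    unfolding cubic_det_def by (simp add: algebra_simps)
  also have "\<dots> = wsigma (u + b) * wsigma (u + c) * (wsigma t)\<^sup>2 * wsigma (u - v) * wsigma (u - w) *
      wsigma (a - b) * wsigma (a - c) *
      (wsigma (?T + v + b) * wsigma (w + b) * (wsigma (?T + w + c) * wsigma (v + c))
      - wsigma (?T + w + b) * wsigma (v + b) * (wsigma (?T + v + c) * wsigma (w + c)))"
    unfolding g h eqs by (simp only: ring_distribs power2_eq_square mult_ac)
  also have "\<dots> = ?f u * ((wsigma t)\<^sup>2 * (wsigma (u - v) * wsigma (u - w) * wsigma (v - w)) *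
      (wsigma (a - b) * wsigma (a - c) * wsigma (b - c)) * wsigma (t + u + v + w + a + b + c))"
    unfolding T eqs cubic_coord_def by (simp add: algebra_simps)
  finally show ?thesis
    using assms by simp
qed

text \<open>The three coordinates have no common zero, so after a rotation the factorization with a
  nonzero pivot is available at every \<open>u\<close>.\<close>

lemma cubic_det_eq_0_iff:
  assumes "wsigma t \<noteq> 0" and "wsigma (a - b) \<noteq> 0" "wsigma (a - c) \<noteq> 0" "wsigma (b - c) \<noteq> 0"
    and sum: "t + a + b + c = 0"
  shows "cubic_det t a b c u v w = 0 \<longleftrightarrow>
    wsigma (u - v) = 0 \<or> wsigma (u - w) = 0 \<or> wsigma (v - w) = 0 \<or> wsigma (u + v + w) = 0"
proof -
  have assms': "wsigma (b - a) \<noteq> 0" "wsigma (c - a) \<noteq> 0" "wsigma (c - b) \<noteq> 0"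
    using assms wsigma_diff_commute by (metis neg_equal_0_iff_equal)+
  have shift: "wsigma (t + z) \<noteq> 0" if "wsigma z = 0" for z
    using that assms(1) period_lattice_diff[of "t + z" z] by (auto simp: wsigma_eq_0_iff)
  have move: "wsigma (u + y') \<noteq> 0" if "wsigma (u + y) = 0" "wsigma (y - y') \<noteq> 0" for y y'
    using that period_lattice_diff[of "u + y" "u + y'"] by (auto simp: wsigma_eq_0_iff)
  have t: "t = - (a + b + c)"
    using sum unfolding eq_neg_iff_add_eq_0 by (simp only: add.assoc)
  have sums: "t + u + v + w + a + b + c = u + v + w" "t + u + v + w + b + c + a = u + v + w"
    "t + u + v + w + c + a + b = u + v + w"
    unfolding t by simp_all
  have "cubic_coord t a b c u \<noteq> 0 \<or> cubic_coord t b c a u \<noteq> 0 \<or> cubic_coord t c a b u \<noteq> 0"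
  proof (rule ccontr)
    assume "\<not> ?thesis"
    then have z: "cubic_coord t a b c u = 0" "cubic_coord t b c a u = 0" "cubic_coord t c a b u = 0"
      by auto
    have "wsigma (u + a) \<noteq> 0" "wsigma (u + b) \<noteq> 0" "wsigma (u + c) \<noteq> 0"
      using z assms assms' shift move unfolding cubic_coord_def add.assoc by (metis mult_eq_0_iff)+
    \<comment> \<open>If one of \<open>u + a\<close>, \<open>u + b\<close>, \<open>u + c\<close>
      were a zero, the coordinate with the shift \<open>t\<close> on it would be nonzero. So the
      vanishing comes from the shifted factors, and two of these would place \<open>a - b\<close> in
      the lattice.\<close>
    then have "wsigma (t + u + a) = 0" "wsigma (t + u + b) = 0"
      using z unfolding cubic_coord_def by auto
    then show False
      using assms(2) period_lattice_diff[of "t + u + a" "t + u + b"] by (auto simp: wsigma_eq_0_iff)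
  qed
  then consider "cubic_coord t a b c u \<noteq> 0" | "cubic_coord t b c a u \<noteq> 0" | "cubic_coord t c a b u \<noteq> 0"
    by blast
  then show ?thesis
  proof cases
    case 1
    show ?thesis
      unfolding cubic_det_pivot[OF 1] sums using assms by auto
  next
    case 2
    show ?thesis
      unfolding cubic_det_rotate[of t b c a, symmetric] cubic_det_pivot[OF 2] sums using assms assms' by auto
  next
    case 3
    show ?thesis
      unfolding cubic_det_rotate[of t b c a, symmetric] cubic_det_rotate[of t c a b, symmetric]
        cubic_det_pivot[OF 3] sums using assms assms' by auto
  qed
qed

text \<open>Bilinear, without complex conjugation, so that its combination with \<open>cross\<close>
  is the determinant.\<close>

definition dot3 :: "complex ^ 3 \<Rightarrow> complex ^ 3 \<Rightarrow> complex" where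
  "dot3 a x = a $ 1 * x $ 1 + a $ 2 * x $ 2 + a $ 3 * x $ 3"

definition cross :: "complex ^ 3 \<Rightarrow> complex ^ 3 \<Rightarrow> complex ^ 3" where
  "cross a b = vector [a $ 2 * b $ 3 - a $ 3 * b $ 2, a $ 3 * b $ 1 - a $ 1 * b $ 3, a $ 1 * b $ 2 - a $ 2 * b $ 1]"

lemma collinear_parametrization:
  obtains F :: "complex \<Rightarrow> complex ^ 3" where
    "\<And>u v w. dot3 (F w) (cross (F u) (F v)) = 0 \<longleftrightarrow>
      u - v \<in> period_lattice \<or> u - w \<in> period_lattice \<or> v - w \<in> period_lattice \<or> u + v + w \<in> period_lattice"
proof -
  \<comment> \<open>The four numbers sum to 0, while \<open>t\<close> and the differences of
    \<open>a\<close>, \<open>b\<close>, \<open>c\<close> are nonzero and imaginary of modulus below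
    \<open>2 * pi\<close>, hence outside the lattice.\<close>
  define t a b c :: complex
    where "t = - (3 * pi / 2) * \<i>" and "a = 0" and "b = pi / 2 * \<i>" and "c = pi * \<i>"
  define F :: "complex \<Rightarrow> complex ^ 3"
    where "F x = vector [cubic_coord t a b c x, cubic_coord t b c a x, cubic_coord t c a b x]" for x
  have not_Ints: "x \<notin> \<int>" if "- 1 < x" "x < 1" "x \<noteq> 0" for x :: real
    using that by (auto elim!: Ints_cases)
  have "dot3 (F w) (cross (F u) (F v)) = cubic_det t a b c u v w" for u v w
    by (simp add: dot3_def cross_def F_def cubic_det_def vector_3 algebra_simps)
  moreover have "wsigma t \<noteq> 0" "wsigma (a - b) \<noteq> 0" "wsigma (a - c) \<noteq> 0" "wsigma (b - c) \<noteq> 0"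
    by (simp_all add: wsigma_eq_0_iff period_lattice_def t_def a_def b_def c_def not_Ints)
  moreover have "t + a + b + c = 0"
    by (simp add: t_def a_def b_def c_def complex_eq_iff)
  ultimately show thesis
    by (intro that[of F]) (simp add: cubic_det_eq_0_iff wsigma_eq_0_iff)
qed

section \<open>Lines in the projective plane\<close>

text \<open>For nonzero \<open>a\<close>, the projective line dual to the point with coordinate
  vector \<open>a\<close>.\<close>

definition hyperplane3 :: "complex ^ 3 \<Rightarrow> (complex ^ 3) set" where
  "hyperplane3 a = {x. dot3 a x = 0}"

lemma subspace_hyperplane3: "vec.subspace (hyperplane3 a)"
proof -
  have "dot3 a (x + y) = dot3 a x + dot3 a y" "dot3 a (k *s x) = k * dot3 a x" "dot3 a 0 = 0" for x y k
    by (simp_all add: dot3_def algebra_simps)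
  then show ?thesis
    by (intro vec.subspaceI) (simp_all add: hyperplane3_def)
qed

text \<open>Triple products with the standard basis vectors recover the coordinates of
  \<open>cross a b\<close> up to sign. The vector \<open>cross a e\<close> then lies in
  \<open>hyperplane3 a\<close> but not in \<open>hyperplane3 b\<close>.\<close>

lemma cross_nonzeroD:
  assumes "cross a b \<noteq> 0"
  shows "a \<noteq> 0" and "\<exists>e. dot3 b (cross a e) \<noteq> 0"
proof -
  show "a \<noteq> 0"
    using assms by (auto simp: cross_def vec_eq_iff forall_3 vector_3)
  have "dot3 b (cross a (vector [1, 0, 0])) = - cross a b $ 1"
    "dot3 b (cross a (vector [0, 1, 0])) = - cross a b $ 2"
    "dot3 b (cross a (vector [0, 0, 1])) = - cross a b $ 3"
    by (simp_all add: dot3_def cross_def vector_3)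
  moreover have "cross a b $ 1 \<noteq> 0 \<or> cross a b $ 2 \<noteq> 0 \<or> cross a b $ 3 \<noteq> 0"
    using assms by (auto simp: vec_eq_iff forall_3)
  ultimately show "\<exists>e. dot3 b (cross a e) \<noteq> 0"
    by (metis neg_equal_0_iff_equal)
qed

lemma dot3_cross [simp]: "dot3 a (cross a b) = 0" "dot3 b (cross a b) = 0"
  by (simp_all add: dot3_def cross_def vector_3 algebra_simps)

lemma hyperplane3_Int:
  assumes "cross a b \<noteq> 0"
  shows "hyperplane3 a \<inter> hyperplane3 b = vec.span {cross a b}"
proof
  show "vec.span {cross a b} \<subseteq> hyperplane3 a \<inter> hyperplane3 b"
    by (intro vec.span_minimal vec.subspace_inter subspace_hyperplane3) (auto simp: hyperplane3_def)
  show "hyperplane3 a \<inter> hyperplane3 b \<subseteq> vec.span {cross a b}"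
  proof
    fix x assume "x \<in> hyperplane3 a \<inter> hyperplane3 b"
    then have x: "dot3 a x = 0" "dot3 b x = 0"
      by (auto simp: hyperplane3_def)
    let ?n = "cross a b"
    have n: "?n $ 2 * x $ 3 = ?n $ 3 * x $ 2" "?n $ 3 * x $ 1 = ?n $ 1 * x $ 3" "?n $ 1 * x $ 2 = ?n $ 2 * x $ 1"
    proof -
      \<comment> \<open>Expansion of the double cross product: (a x b) x x = b (a.x) - a (b.x), so a
        common zero of both forms is parallel to \<open>?n\<close>.\<close>
      have "?n $ 2 * x $ 3 - ?n $ 3 * x $ 2 = b $ 1 * dot3 a x - a $ 1 * dot3 b x"
        "?n $ 3 * x $ 1 - ?n $ 1 * x $ 3 = b $ 2 * dot3 a x - a $ 2 * dot3 b x"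
        "?n $ 1 * x $ 2 - ?n $ 2 * x $ 1 = b $ 3 * dot3 a x - a $ 3 * dot3 b x"
        by (simp_all add: dot3_def cross_def vector_3 algebra_simps)
      then show "?n $ 2 * x $ 3 = ?n $ 3 * x $ 2" "?n $ 3 * x $ 1 = ?n $ 1 * x $ 3" "?n $ 1 * x $ 2 = ?n $ 2 * x $ 1"
        by (simp_all add: x)
    qed
    obtain i where i: "?n $ i \<noteq> 0"
      using assms by (auto simp: vec_eq_iff)
    have "x = (x $ i / ?n $ i) *s ?n"
      using i n exhaust_3[of i] by (auto simp: vec_eq_iff forall_3 field_simps)
    then show "x \<in> vec.span {?n}"
      by (metis vec.span_base vec.span_scale singletonI)
  qed
qed

lemma hyperplane3_Int_in_proj_points:
  assumes "cross a b \<noteq> 0"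
  shows "hyperplane3 a \<inter> hyperplane3 b \<in> proj_points"
  using assms by (simp add: proj_points_def hyperplane3_Int vec.subspace_span)

text \<open>The dimension lies strictly between that of the intersection with
  \<open>hyperplane3 b\<close>, which is 1, and that of the whole space, which is 3.\<close>

lemma hyperplane3_in_proj_lines:
  assumes "cross a b \<noteq> 0"
  shows "hyperplane3 a \<in> proj_lines"
proof -
  have dim1: "vec.dim (hyperplane3 a \<inter> hyperplane3 b) = 1"
    using hyperplane3_Int_in_proj_points[OF assms] by (simp add: proj_points_def)
  obtain e where "dot3 b (cross a e) \<noteq> 0"
    using cross_nonzeroD(2)[OF assms] by blast
  then have "cross a e \<in> hyperplane3 a - hyperplane3 b"
    by (simp add: hyperplane3_def)
  then have "hyperplane3 a \<inter> hyperplane3 b \<subset> hyperplane3 a"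
    by blast
  then have "vec.dim (hyperplane3 a \<inter> hyperplane3 b) < vec.dim (hyperplane3 a)"
    by (intro vec.dim_psubset)
       (metis vec.span_eq_iff subspace_hyperplane3 vec.subspace_inter)
  moreover obtain i where "a $ i \<noteq> 0"
    using cross_nonzeroD(1)[OF assms] by (auto simp: vec_eq_iff)
  then have "axis i 1 \<notin> hyperplane3 a"
    using exhaust_3[of i] by (auto simp: hyperplane3_def dot3_def axis_def)
  then have "hyperplane3 a \<subset> UNIV"
    by auto
  then have "vec.dim (hyperplane3 a) < vec.dim (UNIV :: (complex ^ 3) set)"
    by (intro vec.dim_psubset) (metis vec.span_eq_iff subspace_hyperplane3 vec.span_UNIV)
  ultimately show ?thesis
    using dim1 subspace_hyperplane3 by (simp add: proj_lines_def card_cart_basis)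
qed

lemma hyperplane3_neq:
  assumes "cross a b \<noteq> 0"
  shows "hyperplane3 a \<noteq> hyperplane3 b"
  using hyperplane3_Int_in_proj_points[OF assms] hyperplane3_in_proj_lines[OF assms]
  by (auto simp: proj_points_def proj_lines_def)

section \<open>The net of a finite subgroup of the torus\<close>

text \<open>The map \<open>h\<close> lifts an embedding of \<open>G\<close> into the quotient of the
  complex numbers by \<open>period_lattice\<close>; being a lift, it is additive only modulo the
  lattice.\<close>

lemma net_realizes_of_lattice_hom:
  fixes G :: "('a, 'b) monoid_scheme" (structure) and h :: "'a \<Rightarrow> complex"
  assumes "group G" and fin: "finite (carrier G)"
    and hom: "\<And>x y. x \<in> carrier G \<Longrightarrow> y \<in> carrier G \<Longrightarrow> h (x \<otimes> y) - (h x + h y) \<in> period_lattice"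
    and inj: "\<And>x y. x \<in> carrier G \<Longrightarrow> y \<in> carrier G \<Longrightarrow> h x - h y \<in> period_lattice \<Longrightarrow> x = y"
  shows "\<exists>\<A> C \<X>. three_net \<A> C \<X> \<and> net_realizes C G"
proof -
  interpret group G by fact
  note lattice_simps = period_lattice_add period_lattice_diff
  obtain F :: "complex \<Rightarrow> complex ^ 3" where
    F: "\<And>u v w. dot3 (F w) (cross (F u) (F v)) = 0 \<longleftrightarrow>
      u - v \<in> period_lattice \<or> u - w \<in> period_lattice \<or> v - w \<in> period_lattice \<or> u + v + w \<in> period_lattice"
    by (rule collinear_parametrization) blast
  \<comment> \<open>If \<open>F u\<close> and \<open>F v\<close> were proportional, every
    \<open>F r\<close> would be collinear with them, forcing \<open>r\<close> to be congruent to
    \<open>u\<close>, \<open>v\<close> or \<open>- u - v\<close>. The set \<open>?B\<close> of such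
    real \<open>r\<close> is countable, so some \<open>r\<close> escapes.\<close>
  have cross_F: "cross (F u) (F v) \<noteq> 0" if uv: "u - v \<notin> period_lattice" for u v
  proof
    assume zero: "cross (F u) (F v) = 0"
    let ?L = "8 * ln 2 :: real"
    let ?B = "(\<lambda>n. Re u - of_int n * ?L) ` UNIV \<union> (\<lambda>n. Re v - of_int n * ?L) ` UNIV
        \<union> (\<lambda>n. - Re u - Re v + of_int n * ?L) ` UNIV"
    have "countable ?B"
      by (intro countable_Un countable_image) auto
    then have "?B \<noteq> UNIV"
      using uncountable_UNIV_real by metis
    then obtain r where r: "r \<notin> ?B"
      by blast
    have "dot3 (F (of_real r)) (cross (F u) (F v)) = 0"
      unfolding zero by (simp add: dot3_def)
    then consider "(Re u - r) / ?L \<in> \<int>" | "(Re v - r) / ?L \<in> \<int>" | "(Re u + Re v + r) / ?L \<in> \<int>"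
      unfolding F using uv by (auto simp: period_lattice_def)
    then show False
    proof cases
      case 1
      then obtain n where "r = Re u - of_int n * ?L"
        by (auto elim!: Ints_cases simp: field_simps)
      then show False using r by blast
    next
      case 2
      then obtain n where "r = Re v - of_int n * ?L"
        by (auto elim!: Ints_cases simp: field_simps)
      then show False using r by blast
    next
      case 3
      then obtain n where "r = - Re u - Re v + of_int n * ?L"
        by (auto elim!: Ints_cases simp: field_simps)
      then show False using r by blast
    qed
  qed

  \<comment> \<open>Labels \<open>x\<close> of class \<open>i\<close> sit at \<open>c i + h x\<close>. The offsets \<open>c i\<close> sum to \<open>0\<close> and are pairwise
    distinct modulo the group \<open>T\<close> of \<open>N\<close>-torsion points, which contains the image of \<open>h\<close>.\<close>
  define N where "N = order G"
  have N: "N > 0"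
    unfolding N_def using fin by (simp add: order_gt_0_iff_finite)
  have h_one: "h \<one> \<in> period_lattice"
    using hom[of \<one> \<one>] by simp
  have h_pow: "h (x [^] n) - of_nat n * h x \<in> period_lattice" if "x \<in> carrier G" for x and n :: nat
  proof (induction n)
    case 0
    show ?case using h_one by simp
  next
    case (Suc n)
    have "h (x [^] n \<otimes> x) - (h (x [^] n) + h x) + (h (x [^] n) - of_nat n * h x) \<in> period_lattice"
      by (intro period_lattice_add Suc.IH hom nat_pow_closed that)
    then show ?case
      by (simp add: algebra_simps)
  qed
  define T where "T = {m. of_nat N * m \<in> period_lattice}"
  have T_h: "h x \<in> T" if "x \<in> carrier G" for x
  proof -
    have "h \<one> - of_nat N * h x \<in> period_lattice"
      using h_pow[OF that, of N] pow_order_eq_1[OF that] by (simp add: N_def)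
    from period_lattice_diff[OF h_one this] show ?thesis
      by (simp add: T_def)
  qed
  have T_add: "x + y \<in> T" and T_diff: "x - y \<in> T" if "x \<in> T" "y \<in> T" for x y
    using that by (auto simp: T_def algebra_simps lattice_simps)
  have T_lattice: "x \<in> T" if "x \<in> period_lattice" for x
  proof -
    have "of_nat n * x \<in> period_lattice" for n
      by (induction n) (auto simp: algebra_simps intro: period_lattice_add that)
    then show ?thesis by (simp add: T_def)
  qed

  \<comment> \<open>\<open>N * z\<close> is a quarter of the real period \<open>8 * ln 2\<close>, so
    neither \<open>z\<close> nor \<open>2 * z\<close> is an \<open>N\<close>-torsion point.\<close>
  define z :: complex where "z = of_real (2 * ln 2 / real N)"
  define c :: "3 \<Rightarrow> complex" where "c i = (if i = 1 then z else if i = 2 then 0 else - z)" for i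
  have not_Ints: "x \<notin> \<int>" if "- 1 < x" "x < 1" "x \<noteq> 0" for x :: real
    using that by (auto elim!: Ints_cases)
  have Nz: "of_nat N * z = of_real (2 * ln 2)"
    using N by (simp add: z_def)
  have z_notin: "z \<notin> T" "- z \<notin> T" "z + z \<notin> T" "- z - z \<notin> T"
    using N not_Ints[of "1/4"] not_Ints[of "-1/4"] not_Ints[of "1/2"] not_Ints[of "-1/2"]
    by (simp_all only: T_def mem_Collect_eq ring_distribs mult_minus_right Nz)
       (simp_all add: period_lattice_def)
  have c_diff: "c i - c j \<notin> T" if "i \<noteq> j" for i j
    using that z_notin exhaust_3[of i] exhaust_3[of j] by (auto simp: c_def)
  have c_sum: "c i + c j + c k = 0" if "i \<noteq> j" "k \<noteq> i" "k \<noteq> j" for i j k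
    using that exhaust_3[of i] exhaust_3[of j] exhaust_3[of k] by (auto simp: c_def)
  \<comment> \<open>As the three offsets sum to 0, these sums are differences between the offset of
    a repeated class and that of the missing class.\<close>
  have c_double: "c i + c j + c i \<notin> T" "c i + c j + c j \<notin> T" if "i \<noteq> j" for i j
    using that z_notin exhaust_3[of i] exhaust_3[of j] by (auto simp: c_def)

  define p where "p i x = c i + h x" for i x
  define l where "l i x = hyperplane3 (F (p i x))" for i x
  have p_diff: "p i x - p j y \<notin> period_lattice" if "i \<noteq> j" "x \<in> carrier G" "y \<in> carrier G" for i j x y
  proof
    assume "p i x - p j y \<in> period_lattice"
    then have "(p i x - p j y) - (h x - h y) \<in> T"
      by (intro T_diff T_h that T_lattice)
    then show False
      using c_diff[OF that(1)] by (simp add: p_def algebra_simps)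
  qed
  \<comment> \<open>This excludes a zero sum for three points of which exactly two lie in one class:
    subtracting the torsion labels would leave a doubled offset in \<open>T\<close>.\<close>
  have p_sum: "p i x + p j y + p k w \<notin> period_lattice"
    if "i \<noteq> j" "k = i \<or> k = j" "x \<in> carrier G" "y \<in> carrier G" "w \<in> carrier G" for i j k x y w
  proof
    assume "p i x + p j y + p k w \<in> period_lattice"
    then have "(p i x + p j y + p k w) - (h x + h y + h w) \<in> T"
      by (intro T_diff T_add T_h that T_lattice)
    then have "c i + c j + c k \<in> T"
      by (simp add: p_def algebra_simps)
    then show False
      using c_double[OF that(1)] that(2) by auto
  qed
  have h_sum: "h x + h y + h w \<in> period_lattice \<longleftrightarrow> w = inv (x \<otimes> y)"
    if "x \<in> carrier G" "y \<in> carrier G" "w \<in> carrier G" for x y w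
  proof
    define v where "v = inv (x \<otimes> y)"
    have v: "v \<in> carrier G" "x \<otimes> y \<otimes> v = \<one>"
      using that by (auto simp: v_def)
    have "h (x \<otimes> y \<otimes> v) - (h (x \<otimes> y \<otimes> v) - (h (x \<otimes> y) + h v)) - (h (x \<otimes> y) - (h x + h y)) \<in> period_lattice"
      using h_one v that by (intro period_lattice_diff hom) auto
    then have hv: "h x + h y + h v \<in> period_lattice"
      by (simp add: add.commute)
    then show "h x + h y + h w \<in> period_lattice" if "w = inv (x \<otimes> y)"
      using that by (simp add: v_def)
    assume "h x + h y + h w \<in> period_lattice"
    then have "(h x + h y + h w) - (h x + h y + h v) \<in> period_lattice"
      using hv by (rule period_lattice_diff)
    then show "w = inv (x \<otimes> y)"
      using inj[of w v] that v by (simp add: v_def)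
  qed

  \<comment> \<open>The label of the line of class \<open>k\<close> through the intersection point
    of \<open>l i x\<close> and \<open>l j y\<close>; for \<open>k\<close> equal to \<open>i\<close>
    or \<open>j\<close> it is the given line itself, so one incidence statement serves all
    classes.\<close>
  define third where
    "third i j x y k = (if k = i then x else if k = j then y else inv (x \<otimes> y))" for i j k :: 3 and x y
  have third_closed: "third i j x y k \<in> carrier G" if "x \<in> carrier G" "y \<in> carrier G" for i j k x y
    using that by (auto simp: third_def)
  have incidence: "passes_through (l k w) (l i x \<inter> l j y) \<longleftrightarrow> w = third i j x y k"
    if "i \<noteq> j" and xyw: "x \<in> carrier G" "y \<in> carrier G" "w \<in> carrier G" for i j k x y w
  proof -
    have ne: "cross (F (p i x)) (F (p j y)) \<noteq> 0"
      by (intro cross_F p_diff that)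
    \<comment> \<open>The intersection point is spanned by the cross product, so incidence with the
      third line is the vanishing of the determinant of the three dual points.\<close>
    have "passes_through (l k w) (l i x \<inter> l j y) \<longleftrightarrow> cross (F (p i x)) (F (p j y)) \<in> l k w"
      unfolding passes_through_def l_def hyperplane3_Int[OF ne]
      by (metis insert_subset empty_subsetI vec.span_superset vec.span_minimal subspace_hyperplane3 subset_trans)
    also have "\<dots> \<longleftrightarrow> p i x - p k w \<in> period_lattice \<or> p j y - p k w \<in> period_lattice
        \<or> p i x + p j y + p k w \<in> period_lattice"
      using p_diff[OF that(1-3)] by (simp add: l_def hyperplane3_def F)
    also have "\<dots> \<longleftrightarrow> w = third i j x y k"
    proof (cases "k = i \<or> k = j")
      case True
      then show ?thesis
        using that p_sum[OF that(1) True xyw] p_diff[of i k x w] p_diff[of j k y w] inj[of x w] inj[of y w]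
        by (auto simp: third_def p_def)
    next
      case False
      then have "c i + c j + c k = 0"
        using that(1) by (intro c_sum) auto
      then have "p i x + p j y + p k w = h x + h y + h w"
        unfolding p_def by (metis (no_types, opaque_lifting) add.assoc add.commute add.right_neutral)
      then show ?thesis
        using False that p_diff[of i k x w] p_diff[of j k y w] h_sum[OF xyw] by (auto simp: third_def)
    qed
    finally show ?thesis .
  qed
  have l_inj: "i = j \<and> x = y" if "l i x = l j y" "x \<in> carrier G" "y \<in> carrier G" for i j x y
  proof (rule ccontr)
    assume "\<not> ?thesis"
    then have "p i x - p j y \<notin> period_lattice"
      using p_diff[of i j x y] inj[of x y] that by (cases "i = j") (auto simp: p_def)
    then show False
      using hyperplane3_neq[OF cross_F] that(1) by (simp add: l_def)
  qed
  have l_line: "l i x \<in> proj_lines" for i x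
  proof -
    \<comment> \<open>A single line needs an auxiliary second point of the cubic, not congruent to
      the first; a translate by \<open>z\<close> provides it.\<close>
    have "p i x - (p i x - z) \<notin> period_lattice"
      using z_notin T_lattice by auto
    then show ?thesis
      unfolding l_def by (rule hyperplane3_in_proj_lines[OF cross_F])
  qed

  define C where "C i = l i ` carrier G" for i
  define X where "X = (\<lambda>(i, j, x, y). l i x \<inter> l j y) ` {(i, j, x, y). i \<noteq> j \<and> x \<in> carrier G \<and> y \<in> carrier G}"
  have "three_net (\<Union>i. C i) C X"
    unfolding three_net_def
  proof (intro conjI)
    show "finite (\<Union>i. C i)"
      using fin by (auto simp: C_def)
    show "(\<Union>i. C i) \<subseteq> proj_lines"
      using l_line by (auto simp: C_def)
    show "disjoint_family C"
      unfolding disjoint_family_on_def C_def using l_inj by blast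
    show "\<forall>i. C i \<noteq> {}"
      by (auto simp: C_def)
    have "finite (UNIV \<times> UNIV \<times> carrier G \<times> carrier G :: (3 \<times> 3 \<times> 'a \<times> 'a) set)"
      using fin by auto
    then have "finite {(i :: 3, j :: 3, x, y). i \<noteq> j \<and> x \<in> carrier G \<and> y \<in> carrier G}"
      by (rule rev_finite_subset) auto
    then show "finite X"
      unfolding X_def by (rule finite_imageI)
    show "X \<subseteq> proj_points"
      unfolding X_def l_def using hyperplane3_Int_in_proj_points[OF cross_F[OF p_diff]] by auto
    show "\<forall>i j. i \<noteq> j \<longrightarrow> (\<forall>l\<in>C i. \<forall>l'\<in>C j. l \<inter> l' \<in> X)"
      by (auto simp: C_def X_def)
    show "\<forall>P\<in>X. \<forall>k. \<exists>!l. l \<in> C k \<and> passes_through l P"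
    proof (intro ballI allI)
      fix P and k :: 3
      assume "P \<in> X"
      then obtain i j x y where P: "i \<noteq> j" "x \<in> carrier G" "y \<in> carrier G" "P = l i x \<inter> l j y"
        by (auto simp: X_def)
      show "\<exists>!l. l \<in> C k \<and> passes_through l P"
      proof (rule ex1I[of _ "l k (third i j x y k)"])
        show "l k (third i j x y k) \<in> C k \<and> passes_through (l k (third i j x y k)) P"
          using P third_closed incidence by (auto simp: C_def)
        show "m = l k (third i j x y k)" if "m \<in> C k \<and> passes_through m P" for m
          using that P incidence by (auto simp: C_def)
      qed
    qed
  qed simp
  moreover have "net_realizes C G"
    unfolding net_realizes_def
  proof (intro exI conjI allI ballI)
    \<comment> \<open>Three lines, one from each class, are concurrent iff their labels multiply to \<open>\<one>\<close>;
      hence the inverse in the third labelling.\<close>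
    let ?\<phi> = "\<lambda>i x. l i (if i = 3 then inv x else x)"
    show "bij_betw (?\<phi> i) (carrier G) (C i)" for i
    proof (rule bij_betw_imageI)
      show "inj_on (?\<phi> i) (carrier G)"
        by (rule inj_onI) (auto split: if_splits dest!: l_inj dest: inj_onD[OF inv_inj])
      have "m_inv G ` carrier G = carrier G"
        by (auto simp: image_iff) (metis inv_closed inv_inv)
      then show "?\<phi> i ` carrier G = C i"
        by (cases "i = 3") (auto simp: C_def image_image[of "l 3" "m_inv G", symmetric])
    qed
    fix x y assume "x \<in> carrier G" "y \<in> carrier G"
    then show "passes_through (?\<phi> 3 (x \<otimes> y)) (?\<phi> 1 x \<inter> ?\<phi> 2 y)"
      using incidence[of 1 2 x y "inv (x \<otimes> y)" 3] by (simp add: third_def)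
  qed
  ultimately show ?thesis
    by blast
qed

section \<open>Representatives for the cosets of the integers in the reals\<close>

lemma carrier_real_Mod_Ints:
  "carrier (real_add_group Mod \<int>) = range (\<lambda>a. {x. x - a \<in> \<int>})"
proof -
  have "\<int> #>\<^bsub>real_add_group\<^esub> a = {x. x - a \<in> \<int>}" for a
    by (auto simp: r_coset_def real_add_group_def intro: bexI[of _ "_ - a"])
  then show ?thesis
    by (auto simp: FactGroup_def RCOSETS_def real_add_group_def)
qed

lemma real_Mod_Ints_diff:
  assumes "A \<in> carrier (real_add_group Mod \<int>)" "x \<in> A" "y \<in> A"
  shows "x - y \<in> \<int>"
proof -
  obtain a where "x - a \<in> \<int>" "y - a \<in> \<int>"
    using assms by (auto simp: carrier_real_Mod_Ints)
  then have "(x - a) - (y - a) \<in> \<int>"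
    by (rule Ints_diff)
  then show ?thesis by simp
qed

lemma real_Mod_Ints_some:
  assumes "A \<in> carrier (real_add_group Mod \<int>)"
  shows "(SOME x. x \<in> A) \<in> A"
proof -
  have "\<exists>x. x \<in> A"
    using assms by (auto simp: carrier_real_Mod_Ints) (metis Ints_0 diff_self)
  then show ?thesis by (rule someI_ex)
qed

lemma real_Mod_Ints_some_eq:
  assumes "A \<in> carrier (real_add_group Mod \<int>)" "B \<in> carrier (real_add_group Mod \<int>)"
    and "(SOME x. x \<in> A) - (SOME x. x \<in> B) \<in> \<int>"
  shows "A = B"
proof -
  obtain a b where ab: "A = {x. x - a \<in> \<int>}" "B = {x. x - b \<in> \<int>}"
    using assms by (auto simp: carrier_real_Mod_Ints)
  define r s where "r = (SOME x. x \<in> A)" and "s = (SOME x. x \<in> B)"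
  have rs: "r - a \<in> \<int>" "s - b \<in> \<int>" "r - s \<in> \<int>"
    using assms(3) real_Mod_Ints_some[OF assms(1)] real_Mod_Ints_some[OF assms(2)]
    unfolding r_def[symmetric] s_def[symmetric] by (simp_all add: ab)
  have "(r - s) - (r - a) + (s - b) \<in> \<int>"
    by (intro Ints_add Ints_diff rs)
  then have d: "a - b \<in> \<int>"
    by simp
  have "x - a \<in> \<int> \<longleftrightarrow> x - b \<in> \<int>" for x
    using Ints_add[OF _ d, of "x - a"] Ints_diff[OF _ d, of "x - b"] by auto
  then show ?thesis
    unfolding ab by simp
qed

text \<open>The sum of the chosen representatives lies in the product coset, where it can differ
  from the representative chosen there only by an integer.\<close>

lemma real_Mod_Ints_some_mult:
  assumes A: "A \<in> carrier (real_add_group Mod \<int>)" and B: "B \<in> carrier (real_add_group Mod \<int>)"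
  shows "(SOME x. x \<in> A \<otimes>\<^bsub>real_add_group Mod \<int>\<^esub> B) - ((SOME x. x \<in> A) + (SOME x. x \<in> B)) \<in> \<int>"
proof -
  interpret group "real_add_group Mod \<int>"
    by (intro normal.factorgroup_is_group normal_Ints_real_add_group)
  have AB: "A \<otimes>\<^bsub>real_add_group Mod \<int>\<^esub> B \<in> carrier (real_add_group Mod \<int>)"
    by (intro m_closed A B)
  have "(SOME x. x \<in> A) + (SOME x. x \<in> B) \<in> A \<otimes>\<^bsub>real_add_group Mod \<int>\<^esub> B"
    using real_Mod_Ints_some[OF A] real_Mod_Ints_some[OF B]
    by (auto simp: FactGroup_def set_mult_def real_add_group_def)
  with AB show ?thesis
    using real_Mod_Ints_diff real_Mod_Ints_some by blast
qed

theorem theorem4p4: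
  fixes H :: "(real set \<times> real set) set"
  assumes "subgroup H torus2" and "finite H"
  shows "\<exists>\<A> C \<X>. three_net \<A> C \<X> \<and> net_realizes C (torus2\<lparr>carrier := H\<rparr>)"
proof -
  let ?R = "real_add_group Mod \<int>"
  \<comment> \<open>Scaling the two circle coordinates by the generators \<open>8 * ln 2\<close> and
    \<open>2 * pi * \<i>\<close> turns congruence modulo integers in both coordinates into
    congruence modulo \<open>period_lattice\<close>.\<close>
  define h :: "real set \<times> real set \<Rightarrow> complex"
    where "h p = Complex (8 * ln 2 * (SOME x. x \<in> fst p)) (2 * pi * (SOME x. x \<in> snd p))" for p
  have sub: "fst p \<in> carrier ?R" "snd p \<in> carrier ?R" if "p \<in> H" for p
    using subgroup.subset[OF assms(1)] that by (auto simp: torus2_def)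
  have mult: "p \<otimes>\<^bsub>torus2\<^esub> q = (fst p \<otimes>\<^bsub>?R\<^esub> fst q, snd p \<otimes>\<^bsub>?R\<^esub> snd q)" for p q
    by (simp add: torus2_def mult_DirProd')
  show ?thesis
  proof (rule net_realizes_of_lattice_hom[where h = h])
    show "group (torus2\<lparr>carrier := H\<rparr>)"
      by (rule subgroup.subgroup_is_group[OF assms(1) group_torus2])
    show "finite (carrier (torus2\<lparr>carrier := H\<rparr>))"
      using assms(2) by simp
  next
    fix p q assume "p \<in> carrier (torus2\<lparr>carrier := H\<rparr>)" "q \<in> carrier (torus2\<lparr>carrier := H\<rparr>)"
    then have pq: "p \<in> H" "q \<in> H"
      by simp_all
    have "Re (h (p \<otimes>\<^bsub>torus2\<^esub> q) - (h p + h q)) / (8 * ln 2) =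
        (SOME x. x \<in> fst p \<otimes>\<^bsub>?R\<^esub> fst q) - ((SOME x. x \<in> fst p) + (SOME x. x \<in> fst q))"
      "Im (h (p \<otimes>\<^bsub>torus2\<^esub> q) - (h p + h q)) / (2 * pi) =
        (SOME x. x \<in> snd p \<otimes>\<^bsub>?R\<^esub> snd q) - ((SOME x. x \<in> snd p) + (SOME x. x \<in> snd q))"
      by (simp_all add: h_def mult field_simps)
    then show "h (p \<otimes>\<^bsub>torus2\<lparr>carrier := H\<rparr>\<^esub> q) - (h p + h q) \<in> period_lattice"
      using real_Mod_Ints_some_mult sub pq by (simp add: period_lattice_def)
    assume "h p - h q \<in> period_lattice"
    moreover have "Re (h p - h q) / (8 * ln 2) = (SOME x. x \<in> fst p) - (SOME x. x \<in> fst q)"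
      "Im (h p - h q) / (2 * pi) = (SOME x. x \<in> snd p) - (SOME x. x \<in> snd q)"
      by (simp_all add: h_def field_simps)
    ultimately show "p = q"
      using real_Mod_Ints_some_eq sub pq by (simp add: period_lattice_def prod_eq_iff)
  qed
qed

end
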